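(* Let $\mathcal{O}_{[1]}=\{P\in S^3((k^2)^* ): Q_n(P)\text{ is a square in }k^*\}$ and let $I_{\mathcal{O}_{[1]}}:\mathcal{O}_{[1]}\to k^*\times_{Z_2}k^*/{k^*}^3$ be the map $I_{\mathcal{O}_{[1]}}(P)=[\omega(T_1,T_2),\,I_T(T_1)I_T(T_2)^{-1}]$, where $P=T_1+T_2$ with $T_1,T_2\in T$ coprime. (i) Let $P,P'\in\mathcal{O}_{[1]}$. Then $\mathrm{Sl}(2,k)\cdot P'=\mathrm{Sl}(2,k)\cdot P$ if and only if $I_{\mathcal{O}_{[1]}}(P')=I_{\mathcal{O}_{[1]}}(P)$. (ii) The map $I_{\mathcal{O}_{[1]}}$ induces a bijection from $\mathcal{O}_{[1]}/\mathrm{Sl}(2,k)$ onto $k^*\times_{Z_2}k^*/{k^*}^3$. (iii) Let $P\in\mathcal{O}_{[1]}$ and suppose $P=\lambda_1\phi_1^3+\lambda_2\phi_2^3$ where $\lambda_1,\lambda_2\in k^*$ and $\{\phi_1,\phi_2\}$ is a basis of $(k^2)^*$. Let $G_P=\{g\in\mathrm{Sl}(2,k): g\cdot P=P\}$. Then $$G_P=\{g\in\mathrm{Sl}(2,k): \exists\,\mu\in k^*\text{ such that } g\cdot\phi_1=\mu\phi_1,\ g\cdot\phi_2=\tfrac{1}{\mu}\phi_2\text{ and }\mu^3=1\}.$$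
   Context: $k$ is a field of characteristic different from $2$ and $3$; $x,y$ is the standard coordinate basis of $(k^2)^*$; $S^3((k^2)^* )=\{ax^3+3bx^2y+3cxy^2+dy^3: a,b,c,d\in k\}$ is the space of binary cubics. $\mathrm{Sl}(2,k)$ acts on $(k^2)^*$ by transpose inverse, $(g\cdot\phi)(v)=\phi(g^{-1}v)$, and functorially on $S^3((k^2)^* )$. The symplectic form on $S^3((k^2)^* )$ is $\omega(P,P')=ad'-da'-3bc'+3cb'$ for $P=ax^3+3bx^2y+3cxy^2+dy^3$, $P'=a'x^3+3b'x^2y+3c'xy^2+d'y^3$. The normalised quartic is $Q_n(P)=a^2d^2-3b^2c^2-6abcd+4b^3d+4ac^3$. $T$ is the set of nonzero binary cubics with a triple root, i.e. $T=\{\lambda\phi^3:\lambda\in k^*,\ 0\ne\phi\in(k^2)^*\}$, and $I_T:T\to k^*/{k^*}^3$ is the well-defined map $I_T(\lambda\phi^3)=[\lambda]$. Every $P\in\mathcal{O}_{[1]}$ can be written $P=T_1+T_2$ with $T_1,T_2\in T$ coprime, $T_1,T_2$ are unique up to permutation, and $Q_n(P)=\omega(T_1,T_2)^2$. $k^*\times_{Z_2}k^*/{k^*}^3$ denotes the quotient of $k^*\times (k^*/{k^*}^3)$ by the action of $Z_2=\{\pm1\}$ given by $-1\cdot(\lambda,\alpha)=(-\lambda,\alpha^{-1})$; the class of $(\lambda,\alpha)$ is written $[\lambda,\alpha]$. Hence $I_{\mathcal{O}_{[1]}}$ is well defined. *)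

theory Defs
  imports
    "HOL-Analysis.Determinants"
    "HOL-Computational_Algebra.Polynomial"
    "HOL-Library.Function_Algebras"
    "HOL-Algebra.Coset"
    "HOL-Algebra.Group_Action"
begin

section \<open>The dual plane and its symmetric cube\<close>

definition dual :: "('k::field ^ 2 \<Rightarrow> 'k) set"
  where "dual = {\<phi>. Vector_Spaces.linear (*s) (*) \<phi>}"

definition dual_scale :: "'k::field \<Rightarrow> ('k ^ 2 \<Rightarrow> 'k) \<Rightarrow> 'k ^ 2 \<Rightarrow> 'k"
  where "dual_scale c \<phi> = (\<lambda>v. c * \<phi> v)"

interpretation dual: vector_space "dual_scale :: 'k::field \<Rightarrow> _"
  by unfold_locales (auto simp: dual_scale_def fun_eq_iff algebra_simps)

definition dual_basis :: "('k::field ^ 2 \<Rightarrow> 'k) \<Rightarrow> ('k ^ 2 \<Rightarrow> 'k) \<Rightarrow> bool"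
  where "dual_basis \<phi>\<^sub>1 \<phi>\<^sub>2 \<longleftrightarrow>
    \<phi>\<^sub>1 \<noteq> \<phi>\<^sub>2 \<and> dual.independent {\<phi>\<^sub>1, \<phi>\<^sub>2} \<and> dual.span {\<phi>\<^sub>1, \<phi>\<^sub>2} = dual"

definition x_form :: "'k::field ^ 2 \<Rightarrow> 'k" where "x_form v = v $ 1"
definition y_form :: "'k::field ^ 2 \<Rightarrow> 'k" where "y_form v = v $ 2"

text \<open>
  The symmetric algebra of the dual plane is the polynomial ring in the coordinates \<open>x\<close>, \<open>y\<close>,
  realised as \<open>'k poly poly\<close>: the inner variable is \<open>x\<close>, the outer one is \<open>y\<close>.  These are formal
  polynomials, so no assumption on the size of the field is needed.
\<close>

abbreviation scal :: "'k::field \<Rightarrow> 'k poly poly \<Rightarrow> 'k poly poly"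
  where "scal c P \<equiv> smult [:c:] P"

definition X :: "'k::field poly poly" where "X = [:[:0, 1:]:]"
definition Y :: "'k::field poly poly" where "Y = [:0, 1:]"

text \<open>The degree one part: \<open>\<phi> = \<phi>(e\<^sub>1) x + \<phi>(e\<^sub>2) y\<close>.\<close>

definition form :: "('k::field ^ 2 \<Rightarrow> 'k) \<Rightarrow> 'k poly poly"
  where "form \<phi> = scal (\<phi> (axis 1 1)) X + scal (\<phi> (axis 2 1)) Y"

definition cubic_in :: "'k::field poly poly \<Rightarrow> 'k poly poly \<Rightarrow> 'k \<Rightarrow> 'k \<Rightarrow> 'k \<Rightarrow> 'k \<Rightarrow> 'k poly poly"
  where "cubic_in U V a b c d =
    scal a (U ^ 3) + scal (3 * b) (U ^ 2 * V) + scal (3 * c) (U * V ^ 2) + scal d (V ^ 3)"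

definition binary_cubics :: "'k::field poly poly set"
  where "binary_cubics = {cubic_in X Y a b c d | a b c d. True}"

text \<open>
  The normalised coefficients \<open>a, b, c, d\<close>; the division by \<open>3\<close> is meaningful since the
  characteristic is not \<open>3\<close> (see \<open>coeffs_cubic_in\<close> below).
\<close>

definition coeff_a :: "'k::field poly poly \<Rightarrow> 'k" where "coeff_a P = coeff (coeff P 0) 3"
definition coeff_b :: "'k::field poly poly \<Rightarrow> 'k" where "coeff_b P = coeff (coeff P 1) 2 / 3"
definition coeff_c :: "'k::field poly poly \<Rightarrow> 'k" where "coeff_c P = coeff (coeff P 2) 1 / 3"
definition coeff_d :: "'k::field poly poly \<Rightarrow> 'k" where "coeff_d P = coeff (coeff P 3) 0"

lemma cubic_in_X_Y:
  "cubic_in X Y a b c d = [:[:0, 0, 0, a:], [:0, 0, 3 * b:], [:0, 3 * c:], [:d:]:]"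
  by (simp add: cubic_in_def X_def Y_def power2_eq_square power3_eq_cube)

lemma coeffs_cubic_in:
  assumes "(3::'k::field) \<noteq> 0"
  shows "coeff_a (cubic_in X Y a b c d) = (a::'k)" "coeff_b (cubic_in X Y a b c d) = b"
    "coeff_c (cubic_in X Y a b c d) = c" "coeff_d (cubic_in X Y a b c d) = d"
  using assms
  by (simp_all add: cubic_in_X_Y coeff_a_def coeff_b_def coeff_c_def coeff_d_def
      numeral_2_eq_2 numeral_3_eq_3)

definition symp :: "'k::field poly poly \<Rightarrow> 'k poly poly \<Rightarrow> 'k"
  where "symp P P' = coeff_a P * coeff_d P' - coeff_d P * coeff_a P'
    - 3 * coeff_b P * coeff_c P' + 3 * coeff_c P * coeff_b P'"

definition Qn :: "'k::field poly poly \<Rightarrow> 'k"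
  where "Qn P = (let a = coeff_a P; b = coeff_b P; c = coeff_c P; d = coeff_d P in
    a^2 * d^2 - 3 * b^2 * c^2 - 6 * a * b * c * d + 4 * b^3 * d + 4 * a * c^3)"

section \<open>The action of the special linear group\<close>

definition SL2 :: "('k::field ^ 2 ^ 2) monoid"
  where "SL2 = \<lparr>carrier = {g. det g = 1}, mult = (**), one = mat 1\<rparr>"

definition dual_act :: "'k::field ^ 2 ^ 2 \<Rightarrow> ('k ^ 2 \<Rightarrow> 'k) \<Rightarrow> 'k ^ 2 \<Rightarrow> 'k"
  where "dual_act g \<phi> = (\<lambda>v. \<phi> (matrix_inv g *v v))"

text \<open>
  The induced map on cubics replaces \<open>x\<close> by \<open>g \<cdot> x\<close> and \<open>y\<close> by \<open>g \<cdot> y\<close>.  It is the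
  symmetric cube of \<open>dual_act g\<close>; see \<open>cubic_act_prod\<close>.
\<close>

definition cubic_act :: "'k::field ^ 2 ^ 2 \<Rightarrow> 'k poly poly \<Rightarrow> 'k poly poly"
  where "cubic_act g P = cubic_in (form (dual_act g x_form)) (form (dual_act g y_form))
    (coeff_a P) (coeff_b P) (coeff_c P) (coeff_d P)"

lemma dual_coords:
  assumes "\<phi> \<in> dual"
  shows "\<phi> v = \<phi> (axis 1 1) * v $ 1 + \<phi> (axis 2 1) * v $ 2"
proof -
  interpret Vector_Spaces.linear "(*s)" "(*)" \<phi>
    using assms by (simp add: dual_def)
  have "v = v $ 1 *s axis 1 1 + v $ 2 *s axis 2 1"
    by (simp add: vec_eq_iff axis_def forall_2)
  then have "\<phi> v = \<phi> (v $ 1 *s axis 1 1 + v $ 2 *s axis 2 1)"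
    by simp
  then show ?thesis
    by (simp add: add scale mult.commute)
qed

lemma form_dual_act:
  assumes "\<phi> \<in> dual"
  shows "form (dual_act g \<phi>) = scal (\<phi> (axis 1 1)) (form (dual_act g x_form))
    + scal (\<phi> (axis 2 1)) (form (dual_act g y_form))"
  by (simp add: form_def dual_act_def dual_coords[OF assms, of "matrix_inv g *v _"]
      x_form_def y_form_def smult_add_right smult_add_left[symmetric] algebra_simps
      flip: smult_add_left)

lemma cubic_act_prod:
  assumes "(3::'k::field) \<noteq> 0" "\<phi> \<in> dual" "\<psi> \<in> dual" "(\<theta> :: 'k ^ 2 \<Rightarrow> 'k) \<in> dual"
  shows "cubic_act g (form \<phi> * form \<psi> * form \<theta>) =
    form (dual_act g \<phi>) * form (dual_act g \<psi>) * form (dual_act g \<theta>)"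
proof -
  define p q r s t u where "p = \<phi> (axis 1 1)" "q = \<phi> (axis 2 1)"
    "r = \<psi> (axis 1 1)" "s = \<psi> (axis 2 1)" "t = \<theta> (axis 1 1)" "u = \<theta> (axis 2 1)"
  note d = this
  have prod: "(scal p U + scal q V) * (scal r U + scal s V) * (scal t U + scal u V) =
    cubic_in U V (p * r * t) ((p * r * u + p * s * t + q * r * t) / 3)
      ((p * s * u + q * r * u + q * s * t) / 3) (q * s * u)" for U V
  proof -
    have sm: "scal c P = [:[:c:]:] * P" for c :: 'k and P
      by simp
    have c1: "[:[:c * e:]:] = [:[:c:]:] * [:[:e:]:]"
      and c2: "[:[:c + e:]:] = [:[:c:]:] + [:[:e:]:]" for c e :: 'k
      by simp_all
    have "3 * (e / 3) = e" for e :: 'k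
      using assms(1) by simp
    then show ?thesis
      unfolding cubic_in_def
      by (simp only: sm c1 c2) (simp only: algebra_simps power2_eq_square power3_eq_cube)
  qed
  show ?thesis
    unfolding form_dual_act[OF assms(2)] form_dual_act[OF assms(3)] form_dual_act[OF assms(4)]
    unfolding form_def[of \<phi>] form_def[of \<psi>] form_def[of \<theta>] d[symmetric] prod
    unfolding cubic_act_def coeffs_cubic_in[OF assms(1)] ..
qed

section \<open>Cube classes and the twisted product\<close>

definition kstar :: "'k::field monoid"
  where "kstar = \<lparr>carrier = UNIV - {0}, mult = (*), one = 1\<rparr>"

definition kcubes :: "'k::field set"
  where "kcubes = {t ^ 3 | t. t \<noteq> 0}"

definition cube_classes :: "'k::field set monoid"
  where "cube_classes = kstar Mod kcubes"

definition cube_class :: "'k::field \<Rightarrow> 'k set"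
  where "cube_class c = kcubes #>\<^bsub>kstar\<^esub> c"

definition Z2 :: "int monoid"
  where "Z2 = \<lparr>carrier = {1, - 1}, mult = (*), one = 1\<rparr>"

definition Z2_act :: "int \<Rightarrow> 'k::field \<times> 'k set \<Rightarrow> 'k \<times> 'k set"
  where "Z2_act e = (\<lambda>(c, \<alpha>). if e = 1 then (c, \<alpha>) else (- c, inv\<^bsub>cube_classes\<^esub> \<alpha>))"

definition twisted_product :: "('k::field \<times> 'k set) set set"
  where "twisted_product = orbits Z2 (carrier kstar \<times> carrier cube_classes) Z2_act"

definition twisted_class :: "'k::field \<Rightarrow> 'k set \<Rightarrow> ('k \<times> 'k set) set"
  where "twisted_class c \<alpha> = orbit Z2 Z2_act (c, \<alpha>)"

section \<open>Triple roots and the invariants\<close>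

definition triple_root :: "'k::field poly poly set"
  where "triple_root = {scal c (form \<phi> ^ 3) | c \<phi>. c \<noteq> 0 \<and> \<phi> \<in> dual \<and> \<phi> \<noteq> 0}"

text \<open>
  In \<open>I_T\<close> and \<open>I_O1\<close> the definite description ranges over the class, not over the representing
  data: all decompositions of a cubic give the same class.
\<close>

definition I_T :: "'k::field poly poly \<Rightarrow> 'k set"
  where "I_T P = (THE \<alpha>. \<exists>c \<phi>. c \<noteq> 0 \<and> \<phi> \<in> dual \<and> \<phi> \<noteq> 0 \<and>
    P = scal c (form \<phi> ^ 3) \<and> \<alpha> = cube_class c)"

definition O1 :: "'k::field poly poly set"
  where "O1 = {P \<in> binary_cubics. \<exists>r. r \<noteq> 0 \<and> Qn P = r ^ 2}"

definition I_O1 :: "'k::field poly poly \<Rightarrow> ('k \<times> 'k set) set"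
  where "I_O1 P = (THE \<beta>. \<exists>T\<^sub>1 T\<^sub>2. T\<^sub>1 \<in> triple_root \<and> T\<^sub>2 \<in> triple_root \<and> coprime T\<^sub>1 T\<^sub>2 \<and>
    P = T\<^sub>1 + T\<^sub>2 \<and>
    \<beta> = twisted_class (symp T\<^sub>1 T\<^sub>2) (I_T T\<^sub>1 \<otimes>\<^bsub>cube_classes\<^esub> inv\<^bsub>cube_classes\<^esub> I_T T\<^sub>2))"

end

theory Submission
  imports Defs
begin

text \<open>
  A cubic \<open>c \<phi>\<^sup>3 + d \<psi>\<^sup>3\<close> with \<open>c\<close>, \<open>d\<close> nonzero and \<open>\<phi>\<close>, \<open>\<psi>\<close> independent carries three
  numbers: \<open>c\<close>, \<open>d\<close> and the determinant \<open>D = [\<phi>, \<psi>]\<close> of the two linear forms, called their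
  bracket below.  Everything rests on two facts about these cubics.

  Existence (\<open>O1_two_cubes\<close>): \<open>Qn P\<close> is the discriminant of the Hessian of \<open>P\<close>.  If it is a
  nonzero square then the Hessian has two independent linear factors over the field, and \<open>P\<close> is a
  combination of the cubes of these factors.

  Uniqueness (\<open>two_cubes_unique\<close>): the linear forms are determined up to order and scaling.
  The symmetric trilinear form polarising \<open>c' \<phi>'\<^sup>3 + d' \<psi>'\<^sup>3\<close> vanishes as soon as its first two
  arguments are a zero of \<open>\<phi>'\<close> and a zero of \<open>\<psi>'\<close>; if the same cubic is \<open>c \<phi>\<^sup>3 + d \<psi>\<^sup>3\<close>,
  a zero of \<open>\<psi>\<close> as third argument leaves \<open>c [\<phi>, \<phi>'] [\<phi>, \<psi>'] [\<phi>, \<psi>] = 0\<close>.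

  Because the symplectic form of \<open>c \<phi>\<^sup>3\<close> and \<open>d \<psi>\<^sup>3\<close> is \<open>c d D\<^sup>3\<close>, uniqueness says that the
  invariant is the class of \<open>(w, \<alpha>) = (c d D\<^sup>3, c / d)\<close> (\<open>I_O1_two_cubes\<close>).  On the other side,
  the special linear group acts simply transitively on pairs of linear forms with a given nonzero
  bracket, so the orbit of \<open>c \<phi>\<^sup>3 + d \<psi>\<^sup>3\<close> consists of all \<open>c \<phi>'\<^sup>3 + d \<psi>'\<^sup>3\<close> with
  \<open>[\<phi>', \<psi>'] = D\<close> (\<open>orbit_two_cubes\<close>).  Such a set depends on \<open>(c, d, D)\<close> only up to
  \<open>(c s\<^sup>3, d t\<^sup>3, D) \<sim> (c, d, s t D)\<close> and \<open>(c, d, D) \<sim> (d, c, - D)\<close>.  The first relation with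
  \<open>s = t = d D\<close> brings every triple into the form \<open>(\<alpha>\<^sup>2 / w, \<alpha> / w, w / \<alpha>)\<close>, which can be read
  off from \<open>w\<close> and \<open>\<alpha>\<close>; so the invariant separates orbits (\<open>cubes_with_cong\<close>), and the same
  formula shows that all classes occur (\<open>I_O1_image\<close>).

  A group element fixing \<open>c \<phi>\<^sup>3 + d \<psi>\<^sup>3\<close> scales \<open>\<phi>\<close> and \<open>\<psi>\<close> by cube roots of unity or exchanges
  their lines; in characteristic other than 2 the exchange is incompatible with determinant one.
\<close>

section \<open>Linear forms on the plane\<close>

definition bracket :: "('k::field ^ 2 \<Rightarrow> 'k) \<Rightarrow> ('k ^ 2 \<Rightarrow> 'k) \<Rightarrow> 'k"
  where "bracket \<phi> \<psi> = \<phi> (axis 1 1) * \<psi> (axis 2 1) - \<phi> (axis 2 1) * \<psi> (axis 1 1)"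

definition lin :: "'k::field \<Rightarrow> 'k \<Rightarrow> 'k ^ 2 \<Rightarrow> 'k"
  where "lin p q = (\<lambda>v. p * v $ 1 + q * v $ 2)"

lemma lin_in_dual [simp]: "lin p q \<in> dual"
  unfolding dual_def lin_def
  by (auto simp: Vector_Spaces.linear_iff vector_space_over_itself.vector_space_axioms
      vec.vector_space_axioms algebra_simps)

lemma lin_axis [simp]: "lin p q (axis 1 1) = p" "lin p q (axis 2 1) = q"
  by (simp_all add: lin_def axis_def)

lemma dual_eq_lin:
  assumes "\<phi> \<in> dual"
  shows "\<phi> = lin (\<phi> (axis 1 1)) (\<phi> (axis 2 1))"
  unfolding lin_def by (rule ext, rule dual_coords[OF assms])

lemma dual_eqI:
  assumes "\<phi> \<in> dual" "\<psi> \<in> dual"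
    and "\<phi> (axis 1 1) = \<psi> (axis 1 1)" "\<phi> (axis 2 1) = \<psi> (axis 2 1)"
  shows "\<phi> = \<psi>"
  using assms dual_eq_lin by metis

lemma zero_in_dual: "(0 :: 'k::field ^ 2 \<Rightarrow> 'k) \<in> dual"
  using lin_in_dual[of "0::'k" 0] by (simp add: lin_def zero_fun_def)

lemma dual_scale_in_dual:
  assumes "\<phi> \<in> dual"
  shows "dual_scale s \<phi> \<in> dual"
proof -
  have "dual_scale s \<phi> = lin (s * \<phi> (axis 1 1)) (s * \<phi> (axis 2 1))"
    by (rule ext, subst (1) dual_scale_def, subst (1) dual_coords[OF assms])
      (simp add: lin_def algebra_simps)
  then show ?thesis by simp
qed

lemma bracket_scale [simp]:
  "bracket (dual_scale s \<phi>) \<psi> = s * bracket \<phi> \<psi>"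
  "bracket \<phi> (dual_scale s \<psi>) = s * bracket \<phi> \<psi>"
  by (simp_all add: bracket_def dual_scale_def algebra_simps)

lemma bracket_commute: "bracket \<psi> \<phi> = - bracket \<phi> \<psi>"
  by (simp add: bracket_def algebra_simps)

lemma bracket_self [simp]: "bracket \<phi> \<phi> = 0"
  by (simp add: bracket_def)

lemma bracket_zero [simp]: "bracket 0 \<phi> = 0" "bracket \<phi> 0 = 0"
  by (simp_all add: bracket_def)

lemma bracket_eq_0_imp_proportional:
  assumes "\<phi> \<in> dual" "\<phi>' \<in> dual" "\<phi> \<noteq> 0" "bracket \<phi> \<phi>' = 0"
  obtains s where "\<phi>' = dual_scale s \<phi>"
proof -
  let ?p = "\<phi> (axis 1 1)" and ?q = "\<phi> (axis 2 1)"
  let ?p' = "\<phi>' (axis 1 1)" and ?q' = "\<phi>' (axis 2 1)"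
  have eq: "?p * ?q' = ?q * ?p'"
    using assms(4) by (simp add: bracket_def)
  have "?p \<noteq> 0 \<or> ?q \<noteq> 0"
    using dual_eqI[OF assms(1) zero_in_dual] assms(3) by auto
  then show thesis
  proof
    assume "?p \<noteq> 0"
    then have "\<phi>' = dual_scale (?p' / ?p) \<phi>"
      using eq by (intro dual_eqI assms dual_scale_in_dual) (auto simp: dual_scale_def field_simps)
    then show thesis by (rule that)
  next
    assume "?q \<noteq> 0"
    then have "\<phi>' = dual_scale (?q' / ?q) \<phi>"
      using eq by (intro dual_eqI assms dual_scale_in_dual) (auto simp: dual_scale_def field_simps)
    then show thesis by (rule that)
  qed
qed

lemma dual_basis_bracket:
  assumes "dual_basis \<phi> \<psi>"
  shows "\<phi> \<in> dual" "\<psi> \<in> dual" "bracket \<phi> \<psi> \<noteq> 0"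
proof -
  have span: "dual.span {\<phi>, \<psi>} = dual" and ind: "dual.independent {\<phi>, \<psi>}" and ne: "\<phi> \<noteq> \<psi>"
    using assms by (auto simp: dual_basis_def)
  show d: "\<phi> \<in> dual" "\<psi> \<in> dual"
    using span dual.span_superset[of "{\<phi>, \<psi>}"] by auto
  show "bracket \<phi> \<psi> \<noteq> 0"
  proof
    assume 0: "bracket \<phi> \<psi> = 0"
    have "\<phi> \<noteq> 0"
      using ind dual.dependent_zero[of "{\<phi>, \<psi>}"] by auto
    then obtain s where "\<psi> = dual_scale s \<phi>"
      using bracket_eq_0_imp_proportional[OF d _ 0] by blast
    then have "\<psi> \<in> dual.span {\<phi>}"
      by (simp add: dual.span_base dual.span_scale)
    moreover have "\<psi> \<notin> dual.span {\<phi>}"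
      using ind ne dual.independent_insert[of \<psi> "{\<phi>}"] by (simp add: insert_commute)
    ultimately show False by simp
  qed
qed

section \<open>The action on pairs of linear forms\<close>

lemma matrix_inv_of_invertible:
  assumes "invertible A"
  shows "A ** matrix_inv A = mat 1" "matrix_inv A ** A = mat 1"
  using someI_ex[OF assms[unfolded invertible_def]] by (simp_all add: matrix_inv_def)

lemma matrix_inv_unique:
  fixes A B :: "'k::field ^ 'n ^ 'n"
  assumes "A ** B = mat 1"
  shows "matrix_inv A = B"
proof -
  have BA: "B ** A = mat 1"
    using assms matrix_left_right_inverse by blast
  then have "invertible A"
    using assms by (auto simp: invertible_def)
  then have "matrix_inv A ** A = mat 1"
    by (rule matrix_inv_of_invertible(2))
  then have "matrix_inv A ** A ** B = B"
    by simp
  then show ?thesis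
    using assms by (simp flip: matrix_mul_assoc)
qed

lemma SL2_matrix_inv:
  fixes g :: "'k::field ^ 2 ^ 2"
  assumes "g \<in> carrier SL2"
  shows "det (matrix_inv g) = 1" "matrix_inv (matrix_inv g) = g"
proof -
  have "det g = 1"
    using assms by (simp add: SL2_def)
  then have "invertible g"
    by (simp add: invertible_det_nz)
  then have *: "matrix_inv g ** g = mat 1"
    by (rule matrix_inv_of_invertible(2))
  then show "matrix_inv (matrix_inv g) = g"
    by (rule matrix_inv_unique)
  have "det (matrix_inv g) * det g = 1"
    using * by (metis det_I det_mul)
  then show "det (matrix_inv g) = 1"
    using \<open>det g = 1\<close> by simp
qed

lemma dual_act_eq_lin:
  assumes "\<phi> \<in> dual"
  shows "dual_act g \<phi> = lin (\<phi> (axis 1 1) * matrix_inv g $ 1 $ 1 + \<phi> (axis 2 1) * matrix_inv g $ 2 $ 1)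
    (\<phi> (axis 1 1) * matrix_inv g $ 1 $ 2 + \<phi> (axis 2 1) * matrix_inv g $ 2 $ 2)"
  by (rule ext, unfold dual_act_def, subst dual_coords[OF assms])
    (simp add: lin_def matrix_vector_mult_def sum_2 algebra_simps)

lemma dual_act_in_dual:
  assumes "\<phi> \<in> dual"
  shows "dual_act g \<phi> \<in> dual"
  by (simp add: dual_act_eq_lin[OF assms])

text \<open>
  Precomposing both forms with a matrix multiplies their bracket by its determinant.
\<close>

lemma bracket_dual_act:
  assumes "g \<in> carrier SL2" "\<phi> \<in> dual" "\<psi> \<in> dual"
  shows "bracket (dual_act g \<phi>) (dual_act g \<psi>) = bracket \<phi> \<psi>"
proof -
  have "bracket (dual_act g \<phi>) (dual_act g \<psi>) = det (matrix_inv g) * bracket \<phi> \<psi>"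
    unfolding dual_act_eq_lin[OF assms(2)] dual_act_eq_lin[OF assms(3)] bracket_def lin_axis det_2
    by (simp add: algebra_simps)
  then show ?thesis
    by (simp add: SL2_matrix_inv(1)[OF assms(1)])
qed

text \<open>
  If \<open>M\<close>, \<open>M'\<close> are the matrices whose rows are the two pairs, then \<open>A = M\<inverse> M'\<close> carries the
  first pair to the second by precomposition, and its determinant is the quotient of the brackets.
\<close>

lemma SL2_transitive:
  assumes "\<phi> \<in> dual" "\<psi> \<in> dual" "\<phi>' \<in> dual" "\<psi>' \<in> dual"
    and "bracket \<phi> \<psi> \<noteq> 0" "bracket \<phi>' \<psi>' = bracket \<phi> \<psi>"
  obtains g where "g \<in> carrier SL2" "dual_act g \<phi> = \<phi>'" "dual_act g \<psi> = \<psi>'"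
proof -
  define rows :: "('a ^ 2 \<Rightarrow> 'a) \<Rightarrow> ('a ^ 2 \<Rightarrow> 'a) \<Rightarrow> 'a ^ 2 ^ 2"
    where "rows \<alpha> \<beta> = (\<chi> i j. if i = 1 then \<alpha> (axis j 1) else \<beta> (axis j 1))" for \<alpha> \<beta>
  have det_rows: "det (rows \<alpha> \<beta>) = bracket \<alpha> \<beta>" for \<alpha> \<beta>
    by (simp add: det_2 rows_def bracket_def algebra_simps)
  have inv: "invertible (rows \<phi> \<psi>)"
    using assms(5) by (simp add: invertible_det_nz det_rows)
  define A where "A = matrix_inv (rows \<phi> \<psi>) ** rows \<phi>' \<psi>'"
  have MA: "rows \<phi> \<psi> ** A = rows \<phi>' \<psi>'"
    by (simp add: A_def matrix_mul_assoc matrix_inv_of_invertible(1)[OF inv])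
  then have "det (rows \<phi> \<psi>) * det A = det (rows \<phi>' \<psi>')"
    by (metis det_mul)
  then have detA: "det A = 1"
    using assms(5,6) by (simp add: det_rows)
  then have A: "A \<in> carrier SL2"
    by (simp add: SL2_def)
  have gg: "matrix_inv (matrix_inv A) = A" and g: "matrix_inv A \<in> carrier SL2"
    using SL2_matrix_inv[OF A] by (simp_all add: SL2_def)
  have ent: "(rows \<phi> \<psi> ** A) $ i $ j = rows \<phi>' \<psi>' $ i $ j" for i j
    by (simp add: MA)
  note ent = ent[of 1 1] ent[of 1 2] ent[of 2 1] ent[of 2 2]
  have "dual_act (matrix_inv A) \<phi> = \<phi>'" "dual_act (matrix_inv A) \<psi> = \<psi>'"
    using ent assms(1-4)
    by (auto intro!: dual_eqI simp: dual_act_eq_lin gg rows_def matrix_matrix_mult_def sum_2)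
  with g show thesis
    by (rule that)
qed

section \<open>Sums of two cubes\<close>

definition two_cubes :: "'k::field \<Rightarrow> 'k \<Rightarrow> ('k ^ 2 \<Rightarrow> 'k) \<Rightarrow> ('k ^ 2 \<Rightarrow> 'k) \<Rightarrow> 'k poly poly"
  where "two_cubes c d \<phi> \<psi> = scal c (form \<phi> ^ 3) + scal d (form \<psi> ^ 3)"

lemma two_cubes_commute: "two_cubes d c \<psi> \<phi> = two_cubes c d \<phi> \<psi>"
  by (simp add: two_cubes_def add.commute)

lemma scal_form_cube:
  "scal c (form \<phi> ^ 3) = cubic_in X Y (c * \<phi> (axis 1 1) ^ 3) (c * \<phi> (axis 1 1) ^ 2 * \<phi> (axis 2 1))
    (c * \<phi> (axis 1 1) * \<phi> (axis 2 1) ^ 2) (c * \<phi> (axis 2 1) ^ 3)"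
  unfolding cubic_in_X_Y by (simp add: form_def X_def Y_def power2_eq_square power3_eq_cube algebra_simps)

lemma cubic_in_add:
  "cubic_in U V a b c d + cubic_in U V a' b' c' d' = cubic_in U V (a + a') (b + b') (c + c') (d + d')"
proof -
  have "scal (x + y) W = scal x W + scal y W" for x y :: 'a and W
    by (simp flip: smult_add_left)
  then show ?thesis
    by (simp add: cubic_in_def distrib_left)
qed

lemma form_dual_scale: "form (dual_scale s \<phi>) = scal s (form \<phi>)"
  by (simp add: form_def dual_scale_def smult_add_right mult.commute)

lemma two_cubes_scale:
  "two_cubes c d (dual_scale s \<phi>) (dual_scale t \<psi>) = two_cubes (c * s ^ 3) (d * t ^ 3) \<phi> \<psi>"
  by (simp add: two_cubes_def form_dual_scale smult_power power3_eq_cube mult_ac)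

lemma cubic_act_two_cubes:
  assumes "(3::'k::field) \<noteq> 0" "(\<phi> :: 'k ^ 2 \<Rightarrow> 'k) \<in> dual" "\<psi> \<in> dual"
  shows "cubic_act g (two_cubes c d \<phi> \<psi>) = two_cubes c d (dual_act g \<phi>) (dual_act g \<psi>)"
proof -
  have add: "cubic_act g (P + R) = cubic_act g P + cubic_act g R" for P R :: "'k poly poly"
    by (simp add: cubic_act_def cubic_in_add coeff_a_def coeff_b_def coeff_c_def coeff_d_def
        add_divide_distrib)
  have scal: "cubic_act g (scal e P) = scal e (cubic_act g P)" for e and P :: "'k poly poly"
    by (simp add: cubic_act_def cubic_in_def coeff_a_def coeff_b_def coeff_c_def coeff_d_def
        smult_add_right mult_ac)
  have cube: "cubic_act g (form \<theta> ^ 3) = form (dual_act g \<theta>) ^ 3" if "\<theta> \<in> dual" for \<theta>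
    using cubic_act_prod[OF assms(1) that that that, of g] by (simp add: power3_eq_cube)
  show ?thesis
    by (simp add: two_cubes_def add scal cube assms(2,3))
qed

text \<open>
  The symmetric trilinear form whose restriction to the diagonal is \<open>P\<close>; the normalised
  coefficients make it free of denominators.
\<close>

definition polar :: "'k::field poly poly \<Rightarrow> 'k ^ 2 \<Rightarrow> 'k ^ 2 \<Rightarrow> 'k ^ 2 \<Rightarrow> 'k"
  where "polar P u v w = coeff_a P * u $ 1 * v $ 1 * w $ 1
    + coeff_b P * (u $ 1 * v $ 1 * w $ 2 + u $ 1 * v $ 2 * w $ 1 + u $ 2 * v $ 1 * w $ 1)
    + coeff_c P * (u $ 1 * v $ 2 * w $ 2 + u $ 2 * v $ 1 * w $ 2 + u $ 2 * v $ 2 * w $ 1)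
    + coeff_d P * u $ 2 * v $ 2 * w $ 2"

lemma coeff_scal_form_cube:
  assumes "(3::'k::field) \<noteq> 0"
  shows "coeff_a (scal c (form \<phi> ^ 3)) = c * \<phi> (axis 1 1) ^ 3"
    and "coeff_b (scal c (form \<phi> ^ 3)) = c * \<phi> (axis 1 1) ^ 2 * \<phi> (axis 2 1)"
    and "coeff_c (scal c (form \<phi> ^ 3)) = c * \<phi> (axis 1 1) * \<phi> (axis 2 1) ^ 2"
    and "coeff_d (scal c (form \<phi> ^ 3)) = c * (\<phi> (axis 2 1) :: 'k) ^ 3"
  unfolding scal_form_cube coeffs_cubic_in[OF assms] by simp_all

lemma coeff_two_cubes:
  assumes "(3::'k::field) \<noteq> 0"
  shows "coeff_a (two_cubes c d \<phi> \<psi>) = c * \<phi> (axis 1 1) ^ 3 + d * \<psi> (axis 1 1) ^ 3"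
    and "coeff_b (two_cubes c d \<phi> \<psi>) =
      c * \<phi> (axis 1 1) ^ 2 * \<phi> (axis 2 1) + d * \<psi> (axis 1 1) ^ 2 * \<psi> (axis 2 1)"
    and "coeff_c (two_cubes c d \<phi> \<psi>) =
      c * \<phi> (axis 1 1) * \<phi> (axis 2 1) ^ 2 + d * \<psi> (axis 1 1) * \<psi> (axis 2 1) ^ 2"
    and "coeff_d (two_cubes c d \<phi> \<psi>) = c * \<phi> (axis 2 1) ^ 3 + d * (\<psi> (axis 2 1) :: 'k) ^ 3"
  unfolding two_cubes_def scal_form_cube cubic_in_add coeffs_cubic_in[OF assms] by simp_all

lemma polar_two_cubes:
  assumes "(3::'k::field) \<noteq> 0" "(\<phi> :: 'k ^ 2 \<Rightarrow> 'k) \<in> dual" "\<psi> \<in> dual"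
  shows "polar (two_cubes c d \<phi> \<psi>) u v w = c * \<phi> u * \<phi> v * \<phi> w + d * \<psi> u * \<psi> v * \<psi> w"
  unfolding polar_def coeff_two_cubes[OF assms(1)] dual_coords[OF assms(2), of u]
    dual_coords[OF assms(2), of v] dual_coords[OF assms(2), of w] dual_coords[OF assms(3), of u]
    dual_coords[OF assms(3), of v] dual_coords[OF assms(3), of w]
  by algebra

text \<open>
  A spanning vector of the kernel of a nonzero form, normalised so that evaluating another form
  there yields the bracket.
\<close>

definition root_of :: "('k::field ^ 2 \<Rightarrow> 'k) \<Rightarrow> 'k ^ 2"
  where "root_of \<psi> = (\<chi> i. if i = 1 then \<psi> (axis 2 1) else - \<psi> (axis 1 1))"

lemma eval_root:
  assumes "\<phi> \<in> dual"
  shows "\<phi> (root_of \<psi>) = bracket \<phi> \<psi>"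
  by (subst dual_coords[OF assms]) (simp add: root_of_def bracket_def)

text \<open>
  The quartic is the square of the symplectic form of the two cubes.  In particular its
  non-vanishing forces both coefficients and the bracket to be nonzero.
\<close>

lemma Qn_two_cubes:
  assumes "(3::'k::field) \<noteq> 0"
  shows "Qn (two_cubes c d \<phi> \<psi>) = (c * d * (bracket \<phi> \<psi> :: 'k) ^ 3) ^ 2"
  unfolding Qn_def Let_def coeff_two_cubes[OF assms] bracket_def by algebra

lemma symp_cubes:
  assumes "(3::'k::field) \<noteq> 0"
  shows "symp (scal c (form \<phi> ^ 3)) (scal d (form \<psi> ^ 3)) = c * d * (bracket \<phi> \<psi> :: 'k) ^ 3"
  unfolding symp_def coeff_scal_form_cube[OF assms] bracket_def by algebra

text \<open>
  Once the first forms are known to be proportional, evaluating the polarisation at a zero of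
  \<open>\<phi>'\<close>, a zero of \<open>\<psi>'\<close> and a zero of \<open>\<phi>\<close> makes the second forms proportional, and evaluating
  at zeros of \<open>\<psi>\<close> or of \<open>\<phi>\<close> alone compares the coefficients.
\<close>

lemma two_cubes_unique_aligned:
  fixes \<phi> :: "'k::field ^ 2 \<Rightarrow> 'k"
  assumes three: "(3::'k) \<noteq> 0"
    and dual: "\<phi> \<in> dual" "\<psi> \<in> dual" "\<phi>' \<in> dual" "\<psi>' \<in> dual"
    and d: "d \<noteq> 0"
    and br: "bracket \<phi> \<psi> \<noteq> 0" "bracket \<phi>' \<psi>' \<noteq> 0"
    and eq: "two_cubes c d \<phi> \<psi> = two_cubes c' d' \<phi>' \<psi>'"
    and "bracket \<phi> \<phi>' = 0"
  obtains s t where "s \<noteq> 0" "t \<noteq> 0" "\<phi>' = dual_scale s \<phi>" "\<psi>' = dual_scale t \<psi>"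
    "c = c' * s ^ 3" "d = d' * t ^ 3"
proof -
  have pol: "c * \<phi> u * \<phi> v * \<phi> w + d * \<psi> u * \<psi> v * \<psi> w
      = c' * \<phi>' u * \<phi>' v * \<phi>' w + d' * \<psi>' u * \<psi>' v * \<psi>' w" for u v w
    using eq by (metis polar_two_cubes three dual)
  have nz: "\<phi> \<noteq> 0" "\<psi> \<noteq> 0"
    using br by auto
  obtain s where s: "\<phi>' = dual_scale s \<phi>"
    using bracket_eq_0_imp_proportional[OF dual(1,3) nz(1) assms(10)] .
  have "s \<noteq> 0"
    using br(2) s by auto
  have "d * bracket \<psi> \<phi>' * bracket \<psi> \<psi>' * bracket \<psi> \<phi> = 0"
    using pol[of "root_of \<phi>'" "root_of \<psi>'" "root_of \<phi>"] by (simp add: eval_root dual)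
  then have "bracket \<psi> \<psi>' = 0"
    using d br(1) \<open>s \<noteq> 0\<close> by (simp add: s bracket_commute[of \<psi> \<phi>])
  then obtain t where t: "\<psi>' = dual_scale t \<psi>"
    using bracket_eq_0_imp_proportional[OF dual(2,4) nz(2)] by blast
  have "t \<noteq> 0"
    using br(2) t by auto
  have "c * bracket \<phi> \<psi> ^ 3 = c' * s ^ 3 * bracket \<phi> \<psi> ^ 3"
    using pol[of "root_of \<psi>" "root_of \<psi>" "root_of \<psi>"] unfolding eval_root[OF dual(1)] eval_root[OF dual(2)]
      eval_root[OF dual(3)] eval_root[OF dual(4)] by (simp add: s t power3_eq_cube mult_ac)
  then have c: "c = c' * s ^ 3"
    using br(1) by simp
  have "d * bracket \<psi> \<phi> ^ 3 = d' * t ^ 3 * bracket \<psi> \<phi> ^ 3"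
    using pol[of "root_of \<phi>" "root_of \<phi>" "root_of \<phi>"] unfolding eval_root[OF dual(1)] eval_root[OF dual(2)]
      eval_root[OF dual(3)] eval_root[OF dual(4)] by (simp add: s t power3_eq_cube mult_ac)
  then have "d = d' * t ^ 3"
    using br(1) by (simp add: bracket_commute[of \<psi> \<phi>])
  with s t c \<open>s \<noteq> 0\<close> \<open>t \<noteq> 0\<close> show thesis
    using that by blast
qed

text \<open>
  Two zeros of \<open>\<phi>'\<close> and \<open>\<psi>'\<close> annihilate the right-hand side of the equation, and a zero of
  \<open>\<psi>\<close> then isolates the term of \<open>\<phi>\<close>: so \<open>\<phi>\<close> is proportional to \<open>\<phi>'\<close> or to \<open>\<psi>'\<close>, which
  are the two cases.
\<close>

lemma two_cubes_unique:
  fixes \<phi> :: "'k::field ^ 2 \<Rightarrow> 'k"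
  assumes three: "(3::'k) \<noteq> 0"
    and dual: "\<phi> \<in> dual" "\<psi> \<in> dual" "\<phi>' \<in> dual" "\<psi>' \<in> dual"
    and nz: "c \<noteq> 0" "d \<noteq> 0"
    and br: "bracket \<phi> \<psi> \<noteq> 0" "bracket \<phi>' \<psi>' \<noteq> 0"
    and eq: "two_cubes c d \<phi> \<psi> = two_cubes c' d' \<phi>' \<psi>'"
  obtains (aligned) s t where "s \<noteq> 0" "t \<noteq> 0" "\<phi>' = dual_scale s \<phi>" "\<psi>' = dual_scale t \<psi>"
      "c = c' * s ^ 3" "d = d' * t ^ 3"
    | (swapped) s t where "s \<noteq> 0" "t \<noteq> 0" "\<phi>' = dual_scale s \<psi>" "\<psi>' = dual_scale t \<phi>"
      "d = c' * s ^ 3" "c = d' * t ^ 3"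
proof -
  have "polar (two_cubes c d \<phi> \<psi>) (root_of \<phi>') (root_of \<psi>') (root_of \<psi>)
      = polar (two_cubes c' d' \<phi>' \<psi>') (root_of \<phi>') (root_of \<psi>') (root_of \<psi>)"
    by (simp only: eq)
  then have "c * bracket \<phi> \<phi>' * bracket \<phi> \<psi>' * bracket \<phi> \<psi> = 0"
    by (simp add: polar_two_cubes three dual eval_root)
  then consider "bracket \<phi> \<phi>' = 0" | "bracket \<phi> \<psi>' = 0"
    using nz br by auto
  then show thesis
  proof cases
    case 1
    show thesis
      by (rule two_cubes_unique_aligned[OF three dual nz(2) br eq 1]) (rule aligned)
  next
    case 2
    have eq': "two_cubes c d \<phi> \<psi> = two_cubes d' c' \<psi>' \<phi>'"
      using eq by (simp only: two_cubes_commute)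
    have br': "bracket \<psi>' \<phi>' \<noteq> 0"
      using br(2) by (simp add: bracket_commute[of \<psi>' \<phi>'])
    obtain s t where "s \<noteq> 0" "t \<noteq> 0" "\<psi>' = dual_scale s \<phi>" "\<phi>' = dual_scale t \<psi>"
      "c = d' * s ^ 3" "d = c' * t ^ 3"
      using two_cubes_unique_aligned[OF three dual(1,2,4,3) nz(2) br(1) br' eq' 2] .
    then show thesis
      using swapped by blast
  qed
qed

lemma two_cubes_in_binary_cubics: "two_cubes c d \<phi> \<psi> \<in> binary_cubics"
  unfolding two_cubes_def scal_form_cube cubic_in_add binary_cubics_def by blast

lemma two_cubes_in_O1:
  assumes "(3::'k::field) \<noteq> 0" "c \<noteq> 0" "d \<noteq> 0" "(bracket \<phi> \<psi> :: 'k) \<noteq> 0"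
  shows "two_cubes c d \<phi> \<psi> \<in> O1"
  unfolding O1_def using assms Qn_two_cubes[OF assms(1), of c d \<phi> \<psi>]
  by (auto simp: two_cubes_in_binary_cubics intro!: exI[of _ "c * d * bracket \<phi> \<psi> ^ 3"])

lemma two_cubes_lin:
  "two_cubes c d (lin p q) (lin r s) = cubic_in X Y (c * p ^ 3 + d * r ^ 3)
    (c * p ^ 2 * q + d * r ^ 2 * s) (c * p * q ^ 2 + d * r * s ^ 2) (c * q ^ 3 + d * s ^ 3)"
  unfolding two_cubes_def scal_form_cube cubic_in_add by simp

text \<open>
  The Hessian \<open>A x\<^sup>2 + B x y + C y\<^sup>2\<close> of \<open>P\<close> has discriminant \<open>Qn P\<close>, and its coefficients
  satisfy the syzygies \<open>A c = B b - C a\<close> and \<open>A d = B c - C b\<close>.  When \<open>A \<noteq> 0\<close>, these say that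
  \<open>a, b, c, d\<close> obey the linear recurrence with characteristic roots \<open>\<rho>\<close> and \<open>\<sigma>\<close>, where the
  Hessian is \<open>A (x + \<rho> y) (x + \<sigma> y)\<close>.  A sequence obeying it is a combination of the powers of
  \<open>\<rho>\<close> and \<open>\<sigma>\<close>, and this is exactly the statement that \<open>P\<close> is a combination of
  \<open>(x + \<rho> y)\<^sup>3\<close> and \<open>(x + \<sigma> y)\<^sup>3\<close>.
\<close>

lemma O1_two_cubes:
  fixes P :: "'k::field poly poly"
  assumes two: "(2::'k) \<noteq> 0" and three: "(3::'k) \<noteq> 0" and "P \<in> O1"
  obtains c d \<phi> \<psi> where "\<phi> \<in> dual" "\<psi> \<in> dual" "c \<noteq> 0" "d \<noteq> 0" "bracket \<phi> \<psi> \<noteq> 0"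
    "P = two_cubes c d \<phi> \<psi>"
proof -
  obtain a b c d r where P: "P = cubic_in X Y a b c d" and r: "r \<noteq> 0" and Qr: "Qn P = r ^ 2"
    using assms(3) by (auto simp: O1_def binary_cubics_def)
  define A where "A = a * c - b ^ 2"
  define B where "B = a * d - b * c"
  define C where "C = b * d - c ^ 2"
  have disc: "B ^ 2 - 4 * A * C = r ^ 2"
    unfolding Qr[symmetric] P Qn_def Let_def coeffs_cubic_in[OF three] A_def B_def C_def by algebra
  have rec1: "A * c = B * b - C * a" and rec2: "A * d = B * c - C * b"
    unfolding A_def B_def C_def by algebra+
  have "\<exists>\<kappa> \<mu> p q s t. P = two_cubes \<kappa> \<mu> (lin p q) (lin s t)"
  proof (cases "A = 0")
    case True
    have "B \<noteq> 0"
      using disc r True by auto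
    \<comment> \<open>Here the Hessian is \<open>y (B x + C y)\<close>.\<close>
    have "P = two_cubes (d - a * C ^ 3 / B ^ 3) (a / B ^ 3) (lin 0 1) (lin B C)"
    proof -
      have b: "b = a * C / B" and c: "c = b * C / B"
        using rec1 rec2 \<open>B \<noteq> 0\<close> True by (auto simp: field_simps)
      show ?thesis
        unfolding P two_cubes_lin using \<open>B \<noteq> 0\<close>
        by (intro arg_cong4[where f = "cubic_in X Y"]) (simp_all add: b c field_simps power2_eq_square power3_eq_cube)
    qed
    then show ?thesis by blast
  next
    case False
    define \<rho> where "\<rho> = (B + r) / (2 * A)"
    define \<sigma> where "\<sigma> = (B - r) / (2 * A)"
    have four: "(4::'k) \<noteq> 0"
      using two mult_eq_0_iff[of "2::'k" 2] by simp
    have sub: "\<rho> - \<sigma> = r / A"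
      using two four False by (simp add: \<rho>_def \<sigma>_def field_simps)
    then have ne: "\<rho> - \<sigma> \<noteq> 0"
      using r False by simp
    have add: "A * (\<rho> + \<sigma>) = B"
      using two False by (simp add: \<rho>_def \<sigma>_def field_simps)
    have "4 * A * (A * (\<rho> * \<sigma>)) = B ^ 2 - r ^ 2"
      using two four False by (simp add: \<rho>_def \<sigma>_def field_simps power2_eq_square)
    also have "\<dots> = 4 * A * C"
      using disc by (simp add: algebra_simps)
    finally have mult: "A * (\<rho> * \<sigma>) = C"
      using four False by simp
    \<comment> \<open>The combination of powers is fixed by its first two terms \<open>a\<close> and \<open>b\<close>.\<close>
    define \<kappa> where "\<kappa> = (b - a * \<sigma>) / (\<rho> - \<sigma>)"
    define \<mu> where "\<mu> = (a * \<rho> - b) / (\<rho> - \<sigma>)"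
    have l: "\<kappa> * (\<rho> - \<sigma>) = b - a * \<sigma>" and m: "\<mu> * (\<rho> - \<sigma>) = a * \<rho> - b"
      using ne by (simp_all add: \<kappa>_def \<mu>_def)
    have "(\<kappa> + \<mu>) * (\<rho> - \<sigma>) = a * (\<rho> - \<sigma>)"
      using l m by algebra
    then have a: "\<kappa> + \<mu> = a"
      using ne by simp
    have "(\<kappa> * \<rho> + \<mu> * \<sigma>) * (\<rho> - \<sigma>) = b * (\<rho> - \<sigma>)"
      using l m by algebra
    then have b: "\<kappa> * \<rho> + \<mu> * \<sigma> = b"
      using ne by simp
    have "A * (\<kappa> * \<rho> ^ 2 + \<mu> * \<sigma> ^ 2) = A * c"
      unfolding rec1 add[symmetric] mult[symmetric] a[symmetric] b[symmetric] by algebra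
    then have c: "\<kappa> * \<rho> ^ 2 + \<mu> * \<sigma> ^ 2 = c"
      using False by simp
    have "A * (\<kappa> * \<rho> ^ 3 + \<mu> * \<sigma> ^ 3) = A * d"
      unfolding rec2 add[symmetric] mult[symmetric] b[symmetric] c[symmetric] by algebra
    then have d: "\<kappa> * \<rho> ^ 3 + \<mu> * \<sigma> ^ 3 = d"
      using False by simp
    have "P = two_cubes \<kappa> \<mu> (lin 1 \<rho>) (lin 1 \<sigma>)"
      unfolding P two_cubes_lin using a b c d by simp
    then show ?thesis by blast
  qed
  then obtain \<kappa> \<mu> p q s t where eq: "P = two_cubes \<kappa> \<mu> (lin p q) (lin s t)"
    by blast
  \<comment> \<open>Non-degeneracy comes for free, since \<open>Qn P\<close> is not zero.\<close>
  have "(\<kappa> * \<mu> * bracket (lin p q) (lin s t) ^ 3) ^ 2 \<noteq> 0"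
    using Qr r unfolding eq Qn_two_cubes[OF three] by simp
  then have "\<kappa> \<noteq> 0" "\<mu> \<noteq> 0" "bracket (lin p q) (lin s t) \<noteq> 0"
    by auto
  with eq show thesis
    by (intro that[of "lin p q" "lin s t" \<kappa> \<mu>]) simp_all
qed

section \<open>Cube classes\<close>

lemma kstar_comm_group: "comm_group (kstar :: 'k::field monoid)"
  by (rule comm_groupI) (auto simp: kstar_def intro!: bexI[where x = "inverse _"])

lemma kcubes_normal: "(kcubes :: 'k::field set) \<lhd> kstar"
proof -
  interpret comm_group "kstar :: 'k monoid"
    by (rule kstar_comm_group)
  have inv: "inv\<^bsub>kstar\<^esub> x = inverse x" if "x \<noteq> 0" for x :: 'k
    by (rule inv_equality) (use that in \<open>auto simp: kstar_def\<close>)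
  have "subgroup (kcubes :: 'k set) kstar"
  proof (rule subgroupI)
    show "(kcubes :: 'k set) \<subseteq> carrier kstar" "(kcubes :: 'k set) \<noteq> {}"
      by (auto simp: kcubes_def kstar_def intro: exI[of _ 1])
  next
    fix a :: 'k assume "a \<in> kcubes"
    then obtain t where "a = t ^ 3" "t \<noteq> 0"
      by (auto simp: kcubes_def)
    then show "inv\<^bsub>kstar\<^esub> a \<in> kcubes"
      by (auto simp: inv kcubes_def power_inverse intro!: exI[of _ "inverse t"])
  next
    fix a b :: 'k assume "a \<in> kcubes" "b \<in> kcubes"
    then obtain s t where "a = s ^ 3" "b = t ^ 3" "s \<noteq> 0" "t \<noteq> 0"
      by (auto simp: kcubes_def)
    then show "a \<otimes>\<^bsub>kstar\<^esub> b \<in> kcubes"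
      by (auto simp: kstar_def kcubes_def power_mult_distrib intro!: exI[of _ "s * t"])
  qed
  then show ?thesis
    by (rule subgroup_imp_normal)
qed

lemma cube_class_eq_iff:
  fixes a b :: "'k::field"
  assumes "a \<noteq> 0" "b \<noteq> 0"
  shows "cube_class a = cube_class b \<longleftrightarrow> (\<exists>t. t \<noteq> 0 \<and> a = b * t ^ 3)"
proof -
  interpret normal "kcubes :: 'k set" kstar
    by (rule kcubes_normal)
  have in_iff: "x \<in> cube_class y \<longleftrightarrow> (\<exists>t. t \<noteq> 0 \<and> x = y * t ^ 3)" for x y :: 'k
    by (auto simp: cube_class_def r_coset_def kcubes_def kstar_def mult.commute)
  have "cube_class a = cube_class b \<longleftrightarrow> a \<in> cube_class b"
  proof
    assume "cube_class a = cube_class b"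
    moreover have "a \<in> cube_class a"
      unfolding in_iff by (rule exI[of _ 1]) simp
    ultimately show "a \<in> cube_class b"
      by simp
  next
    assume "a \<in> cube_class b"
    then show "cube_class a = cube_class b"
      unfolding cube_class_def using assms repr_independence[OF _ _ subgroup_axioms]
      by (simp add: kstar_def)
  qed
  then show ?thesis
    by (simp add: in_iff)
qed

lemma carrier_cube_classes:
  "carrier cube_classes = {cube_class a | a. (a :: 'k::field) \<noteq> 0}"
  by (auto simp: cube_classes_def FactGroup_def RCOSETS_def cube_class_def kstar_def)

lemma cube_class_hom: "group_hom kstar cube_classes (cube_class :: 'k::field \<Rightarrow> _)"
proof -
  interpret normal "kcubes :: 'k set" kstar
    by (rule kcubes_normal)
  have "cube_class \<in> hom kstar (cube_classes :: 'k set monoid)"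
    using r_coset_hom_Mod by (simp add: cube_class_def[abs_def] cube_classes_def)
  then show ?thesis
    using factorgroup_is_group is_group
    by (simp add: group_hom_def group_hom_axioms_def cube_classes_def)
qed

lemma inv_cube_class:
  fixes a :: "'k::field"
  assumes "a \<noteq> 0"
  shows "inv\<^bsub>cube_classes\<^esub> (cube_class a) = cube_class (1 / a)"
proof -
  interpret group_hom "kstar :: 'k monoid" cube_classes cube_class
    by (rule cube_class_hom)
  have "inv\<^bsub>kstar\<^esub> a = 1 / a"
    by (rule G.inv_equality) (use assms in \<open>auto simp: kstar_def\<close>)
  then show ?thesis
    using hom_inv[of a] assms by (simp add: kstar_def)
qed

lemma cube_class_divide:
  fixes a b :: "'k::field"
  assumes "a \<noteq> 0" "b \<noteq> 0"
  shows "cube_class a \<otimes>\<^bsub>cube_classes\<^esub> inv\<^bsub>cube_classes\<^esub> cube_class b = cube_class (a / b)"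
proof -
  interpret group_hom "kstar :: 'k monoid" cube_classes cube_class
    by (rule cube_class_hom)
  show ?thesis
    using hom_mult[of a "1 / b"] assms by (simp add: inv_cube_class kstar_def)
qed

lemma twisted_class_cube_class:
  fixes a :: "'k::field"
  assumes "a \<noteq> 0"
  shows "twisted_class w (cube_class a) = {(w, cube_class a), (- w, cube_class (1 / a))}"
proof -
  have "twisted_class w (cube_class a) =
      {Z2_act 1 (w, cube_class a), Z2_act (- 1) (w, cube_class a)}"
    by (auto simp only: twisted_class_def orbit_def Z2_def partial_object.simps)
  then show ?thesis
    by (simp add: Z2_act_def inv_cube_class[OF assms])
qed

lemma twisted_product_eq:
  "twisted_product = {twisted_class w (cube_class a) | w a. (w :: 'k::field) \<noteq> 0 \<and> a \<noteq> 0}"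
  by (auto simp: twisted_product_def orbits_def twisted_class_def carrier_cube_classes kstar_def)

section \<open>The invariant of a sum of two cubes\<close>

text \<open>
  Comparing the coefficients of \<open>x\<^sup>3\<close> or of \<open>y\<^sup>3\<close>, whichever is nonzero, shows that two
  presentations of one triple root differ by a cube.
\<close>

lemma I_T_cube:
  fixes \<phi> :: "'k::field ^ 2 \<Rightarrow> 'k"
  assumes three: "(3::'k) \<noteq> 0" and c: "c \<noteq> 0" and \<phi>: "\<phi> \<in> dual" "\<phi> \<noteq> 0"
  shows "I_T (scal c (form \<phi> ^ 3)) = cube_class c"
  unfolding I_T_def
proof (rule the_equality)
  show "\<exists>c' \<phi>'. c' \<noteq> 0 \<and> \<phi>' \<in> dual \<and> \<phi>' \<noteq> 0 \<and>
      scal c (form \<phi> ^ 3) = scal c' (form \<phi>' ^ 3) \<and> cube_class c = cube_class c'"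
    using c \<phi> by blast
next
  fix \<alpha>
  assume "\<exists>c' \<phi>'. c' \<noteq> 0 \<and> \<phi>' \<in> dual \<and> \<phi>' \<noteq> 0 \<and>
      scal c (form \<phi> ^ 3) = scal c' (form \<phi>' ^ 3) \<and> \<alpha> = cube_class c'"
  then obtain c' \<phi>' where c': "c' \<noteq> 0" "\<phi>' \<in> dual" and
    eq: "scal c (form \<phi> ^ 3) = scal c' (form \<phi>' ^ 3)" and \<alpha>: "\<alpha> = cube_class c'"
    by blast
  let ?p = "\<phi> (axis 1 1)" and ?q = "\<phi> (axis 2 1)"
  let ?p' = "\<phi>' (axis 1 1)" and ?q' = "\<phi>' (axis 2 1)"
  have pq: "c * ?p ^ 3 = c' * ?p' ^ 3" "c * ?q ^ 3 = c' * ?q' ^ 3"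
    using eq by (metis coeff_scal_form_cube(1)[OF three], metis coeff_scal_form_cube(4)[OF three])
  have "c' = c * (x / x') ^ 3 \<and> x / x' \<noteq> 0" if "c * x ^ 3 = c' * x' ^ 3" "x \<noteq> 0" for x x'
    using that c c' by (auto simp: field_simps power_divide)
  moreover have "?p \<noteq> 0 \<or> ?q \<noteq> 0"
    using dual_eqI[OF \<phi>(1) zero_in_dual] \<phi>(2) by auto
  ultimately have "\<exists>t. t \<noteq> 0 \<and> c' = c * t ^ 3"
    using pq by blast
  then show "\<alpha> = cube_class c"
    using c c' by (simp add: \<alpha> cube_class_eq_iff)
qed

text \<open>
  A common divisor of the two cubes divides the fifth power of every linear combination
  of \<open>\<phi>\<close> and \<open>\<psi>\<close>, because each monomial of degree 5 in two variables is divisible by one of the two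
  cubes.  If the forms are independent, this gives a common divisor of \<open>x\<^sup>5\<close> and \<open>y\<^sup>5\<close>, which is a
  unit.
\<close>

lemma coprime_cubes_iff:
  fixes \<phi> :: "'k::field ^ 2 \<Rightarrow> 'k"
  assumes dual: "\<phi> \<in> dual" "\<psi> \<in> dual" and nz: "\<phi> \<noteq> 0" and c: "c \<noteq> 0" "d \<noteq> 0"
  shows "coprime (scal c (form \<phi> ^ 3)) (scal d (form \<psi> ^ 3)) \<longleftrightarrow> bracket \<phi> \<psi> \<noteq> 0"
proof
  let ?D = "bracket \<phi> \<psi>"
  assume cop: "coprime (scal c (form \<phi> ^ 3)) (scal d (form \<psi> ^ 3))"
  show "?D \<noteq> 0"
  proof
    assume "?D = 0"
    then obtain s where s: "\<psi> = dual_scale s \<phi>"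
      using bracket_eq_0_imp_proportional[OF dual nz] by blast
    have 1: "form \<phi> dvd scal c (form \<phi> ^ 3)"
      by (intro dvd_smult) (simp add: power3_eq_cube)
    have 2: "form \<phi> dvd scal d (form \<psi> ^ 3)"
      by (simp add: s form_dual_scale smult_power power3_eq_cube dvd_smult)
    have unit: "form \<phi> dvd 1"
      using cop 1 2 by (rule coprime_common_divisor)
    have f: "form \<phi> = [:[:0, \<phi> (axis 1 1):], [:\<phi> (axis 2 1):]:]"
      by (simp add: form_def X_def Y_def)
    have "\<phi> (axis 2 1) = 0"
    proof (rule ccontr)
      assume "\<phi> (axis 2 1) \<noteq> 0"
      then show False using unit by (auto simp: f is_unit_poly_iff)
    qed
    moreover have "\<phi> (axis 1 1) = 0"
      using unit \<open>\<phi> (axis 2 1) = 0\<close> by (auto simp: f is_unit_poly_iff split: if_splits)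
    ultimately show False
      using dual_eqI[OF dual(1) zero_in_dual] nz by simp
  qed
next
  let ?D = "bracket \<phi> \<psi>"
  assume D: "?D \<noteq> 0"
  let ?F = "scal c (form \<phi> ^ 3)" and ?G = "scal d (form \<psi> ^ 3)"
  have comb: "e dvd (scal x (form \<phi>) + scal y (form \<psi>)) ^ 5" if "e dvd ?F" "e dvd ?G" for e x y
  proof -
    have "form \<phi> ^ 3 = scal (1 / c) ?F" "form \<psi> ^ 3 = scal (1 / d) ?G"
      using c by (simp_all add: pCons_one)
    then have e: "e dvd form \<phi> ^ 3" "e dvd form \<psi> ^ 3"
      using that by (metis dvd_smult)+
    define u v where "u = scal x (form \<phi>)" and "v = scal y (form \<psi>)"
    have "e dvd u ^ 3" "e dvd v ^ 3"
      using e by (simp_all add: u_def v_def smult_power dvd_smult)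
    moreover have "(u + v) ^ 5 = u ^ 3 * (u ^ 2 + 5 * u * v + 10 * v ^ 2)
        + v ^ 3 * (10 * u ^ 2 + 5 * u * v + v ^ 2)"
      by algebra
    ultimately show ?thesis
      unfolding u_def[symmetric] v_def[symmetric] by simp
  qed
  let ?p = "\<phi> (axis 1 1)" and ?q = "\<phi> (axis 2 1)"
  let ?r = "\<psi> (axis 1 1)" and ?s = "\<psi> (axis 2 1)"
  have lin_comb: "scal x (form \<phi>) + scal y (form \<psi>)
      = [:[:0, x * ?p + y * ?r:], [:x * ?q + y * ?s:]:]" for x y
    by (simp add: form_def X_def Y_def)
  have D': "?p * ?s - ?q * ?r = ?D"
    by (simp add: bracket_def)
  have X: "scal (?s / ?D) (form \<phi>) + scal (- ?q / ?D) (form \<psi>) = X"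
    unfolding lin_comb X_def using D D' by (simp add: field_simps)
  have Y: "scal (- ?r / ?D) (form \<phi>) + scal (?p / ?D) (form \<psi>) = Y"
    unfolding lin_comb Y_def using D D' by (simp add: field_simps)
  show "coprime ?F ?G"
  proof (rule coprimeI)
    fix e assume e: "e dvd ?F" "e dvd ?G"
    \<comment> \<open>Dividing \<open>x\<^sup>5\<close>, which is constant in the outer variable, makes \<open>e\<close> a polynomial \<open>f\<close> in \<open>x\<close>
      alone; dividing the monic \<open>y\<^sup>5\<close> then makes \<open>f\<close> a unit.\<close>
    have eX: "e dvd X ^ 5" and eY: "e dvd Y ^ 5"
      using comb[OF e] X Y by metis+
    have "X ^ 5 = [:[:0, 1:] ^ 5 :: 'k poly:]"
      unfolding X_def by (simp add: eval_nat_numeral)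
    then have "degree (X ^ 5 :: 'k poly poly) = 0" "(X ^ 5 :: 'k poly poly) \<noteq> 0"
      by simp_all
    then have "degree e = 0"
      using eX dvd_imp_degree_le by fastforce
    then obtain f where f: "e = [:f:]"
      by (rule degree_eq_zeroE)
    have "f dvd coeff (Y ^ 5) 5"
      using eY unfolding f const_poly_dvd_iff by blast
    also have "Y ^ 5 = monom (1 :: 'k poly) 5"
      by (simp add: Y_def monom_altdef)
    finally show "is_unit e"
      by (simp add: f is_unit_const_poly_iff)
  qed
qed

text \<open>
  The invariant of \<open>c \<phi>\<^sup>3 + d \<psi>\<^sup>3\<close> when \<open>\<phi>\<close> and \<open>\<psi>\<close> have bracket \<open>D\<close>.
\<close>

definition cubes_class :: "'k::field \<Rightarrow> 'k \<Rightarrow> 'k \<Rightarrow> ('k \<times> 'k set) set"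
  where "cubes_class c d D = twisted_class (c * d * D ^ 3) (cube_class (c / d))"

lemma cubes_class_scale:
  fixes c :: "'k::field"
  assumes "c \<noteq> 0" "d \<noteq> 0" "s \<noteq> 0" "t \<noteq> 0"
  shows "cubes_class (c * s ^ 3) (d * t ^ 3) D = cubes_class c d (s * t * D)"
proof -
  have "cube_class (c * s ^ 3 / (d * t ^ 3)) = cube_class (c / d)"
    using assms by (subst cube_class_eq_iff)
      (auto intro!: exI[of _ "s / t"] simp: power_divide)
  moreover have "c * s ^ 3 * (d * t ^ 3) * D ^ 3 = c * d * (s * t * D) ^ 3"
    by (simp only: power_mult_distrib mult_ac)
  ultimately show ?thesis
    by (simp only: cubes_class_def)
qed

lemma cubes_class_commute:
  fixes c :: "'k::field"
  assumes "c \<noteq> 0" "d \<noteq> 0"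
  shows "cubes_class d c (- D) = cubes_class c d D"
  using assms by (auto simp: cubes_class_def twisted_class_cube_class mult_ac)

text \<open>
  The class does not depend on the decomposition: by uniqueness, another decomposition into coprime
  triple roots arises by rescaling the linear forms and possibly exchanging them, and the class is
  insensitive to both.
\<close>

lemma I_O1_two_cubes:
  fixes \<phi> :: "'k::field ^ 2 \<Rightarrow> 'k"
  assumes three: "(3::'k) \<noteq> 0" and dual: "\<phi> \<in> dual" "\<psi> \<in> dual"
    and c: "c \<noteq> 0" "d \<noteq> 0" and D: "bracket \<phi> \<psi> \<noteq> 0"
  shows "I_O1 (two_cubes c d \<phi> \<psi>) = cubes_class c d (bracket \<phi> \<psi>)"
proof -
  have class_eq: "twisted_class (symp T\<^sub>1 T\<^sub>2) (I_T T\<^sub>1 \<otimes>\<^bsub>cube_classes\<^esub> inv\<^bsub>cube_classes\<^esub> I_T T\<^sub>2)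
      = cubes_class c d (bracket \<phi> \<psi>)"
    if "c \<noteq> 0" "d \<noteq> 0" "\<phi> \<in> dual" "\<psi> \<in> dual" "\<phi> \<noteq> 0" "\<psi> \<noteq> 0"
      "T\<^sub>1 = scal c (form \<phi> ^ 3)" "T\<^sub>2 = scal d (form \<psi> ^ 3)"
    for c d and \<phi> \<psi> :: "'k ^ 2 \<Rightarrow> 'k" and T\<^sub>1 T\<^sub>2
    unfolding cubes_class_def that(7,8) symp_cubes[OF three]
    using that(1-6) by (simp add: I_T_cube[OF three] cube_class_divide)
  have nz: "\<phi> \<noteq> 0" "\<psi> \<noteq> 0"
    using D by auto
  show ?thesis
    unfolding I_O1_def
  proof (rule the_equality)
    show "\<exists>T\<^sub>1 T\<^sub>2. T\<^sub>1 \<in> triple_root \<and> T\<^sub>2 \<in> triple_root \<and> coprime T\<^sub>1 T\<^sub>2 \<and>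
      two_cubes c d \<phi> \<psi> = T\<^sub>1 + T\<^sub>2 \<and> cubes_class c d (bracket \<phi> \<psi>) =
        twisted_class (symp T\<^sub>1 T\<^sub>2) (I_T T\<^sub>1 \<otimes>\<^bsub>cube_classes\<^esub> inv\<^bsub>cube_classes\<^esub> I_T T\<^sub>2)"
    proof (intro exI conjI)
      show "scal c (form \<phi> ^ 3) \<in> triple_root" "scal d (form \<psi> ^ 3) \<in> triple_root"
        using c dual nz unfolding triple_root_def by blast+
      show "coprime (scal c (form \<phi> ^ 3)) (scal d (form \<psi> ^ 3))"
        using coprime_cubes_iff[OF dual nz(1) c] D by simp
      show "two_cubes c d \<phi> \<psi> = scal c (form \<phi> ^ 3) + scal d (form \<psi> ^ 3)"
        by (simp add: two_cubes_def)
    qed (rule class_eq[symmetric, OF c dual nz refl refl])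
  next
    fix \<beta>
    assume "\<exists>T\<^sub>1 T\<^sub>2. T\<^sub>1 \<in> triple_root \<and> T\<^sub>2 \<in> triple_root \<and> coprime T\<^sub>1 T\<^sub>2 \<and>
      two_cubes c d \<phi> \<psi> = T\<^sub>1 + T\<^sub>2 \<and> \<beta> =
        twisted_class (symp T\<^sub>1 T\<^sub>2) (I_T T\<^sub>1 \<otimes>\<^bsub>cube_classes\<^esub> inv\<^bsub>cube_classes\<^esub> I_T T\<^sub>2)"
    then obtain T\<^sub>1 T\<^sub>2 where T: "T\<^sub>1 \<in> triple_root" "T\<^sub>2 \<in> triple_root" and cop: "coprime T\<^sub>1 T\<^sub>2"
      and sum: "two_cubes c d \<phi> \<psi> = T\<^sub>1 + T\<^sub>2" and \<beta>: "\<beta> =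
        twisted_class (symp T\<^sub>1 T\<^sub>2) (I_T T\<^sub>1 \<otimes>\<^bsub>cube_classes\<^esub> inv\<^bsub>cube_classes\<^esub> I_T T\<^sub>2)"
      by blast
    obtain c' \<phi>' where T1: "c' \<noteq> 0" "\<phi>' \<in> dual" "\<phi>' \<noteq> 0" "T\<^sub>1 = scal c' (form \<phi>' ^ 3)"
      using T(1) unfolding triple_root_def by blast
    obtain d' \<psi>' where T2: "d' \<noteq> 0" "\<psi>' \<in> dual" "\<psi>' \<noteq> 0" "T\<^sub>2 = scal d' (form \<psi>' ^ 3)"
      using T(2) unfolding triple_root_def by blast
    have D': "bracket \<phi>' \<psi>' \<noteq> 0"
      using cop coprime_cubes_iff[OF T1(2) T2(2) T1(3) T1(1) T2(1)] T1(4) T2(4) by simp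
    have eq: "two_cubes c d \<phi> \<psi> = two_cubes c' d' \<phi>' \<psi>'"
      using sum T1(4) T2(4) by (simp add: two_cubes_def)
    have \<beta>': "\<beta> = cubes_class c' d' (bracket \<phi>' \<psi>')"
      unfolding \<beta> by (rule class_eq) (fact T1 T2)+
    show "\<beta> = cubes_class c d (bracket \<phi> \<psi>)"
      using three dual T1(2) T2(2) c D D' eq
    proof (cases rule: two_cubes_unique)
      case (aligned s t)
      then show ?thesis
        using cubes_class_scale[OF T1(1) T2(1) aligned(1,2)] by (simp add: \<beta>' mult_ac)
    next
      case (swapped s t)
      have "cubes_class c d (bracket \<phi> \<psi>) = cubes_class d c (bracket \<psi> \<phi>)"
        using cubes_class_commute[OF c] by (simp add: bracket_commute[of \<psi> \<phi>])
      then show ?thesis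
        using cubes_class_scale[OF T1(1) T2(1) swapped(1,2)] swapped by (simp add: \<beta>' mult_ac)
    qed
  qed
qed

section \<open>The orbits\<close>

text \<open>
  The orbits, parametrised without reference to the group.
\<close>

definition cubes_with :: "'k::field \<Rightarrow> 'k \<Rightarrow> 'k \<Rightarrow> 'k poly poly set"
  where "cubes_with c d D = {two_cubes c d \<phi> \<psi> | \<phi> \<psi>. \<phi> \<in> dual \<and> \<psi> \<in> dual \<and> bracket \<phi> \<psi> = D}"

lemma orbit_two_cubes:
  fixes \<phi> :: "'k::field ^ 2 \<Rightarrow> 'k"
  assumes three: "(3::'k) \<noteq> 0" and dual: "\<phi> \<in> dual" "\<psi> \<in> dual" and D: "bracket \<phi> \<psi> \<noteq> 0"
  shows "orbit SL2 cubic_act (two_cubes c d \<phi> \<psi>) = cubes_with c d (bracket \<phi> \<psi>)"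
proof (intro equalityI subsetI)
  fix P assume "P \<in> orbit SL2 cubic_act (two_cubes c d \<phi> \<psi>)"
  then obtain g where "g \<in> carrier SL2" "P = two_cubes c d (dual_act g \<phi>) (dual_act g \<psi>)"
    by (auto simp: orbit_def cubic_act_two_cubes[OF three dual])
  then show "P \<in> cubes_with c d (bracket \<phi> \<psi>)"
    unfolding cubes_with_def using dual dual_act_in_dual bracket_dual_act by blast
next
  fix P assume "P \<in> cubes_with c d (bracket \<phi> \<psi>)"
  then obtain \<phi>' \<psi>' where P: "P = two_cubes c d \<phi>' \<psi>'"
    and dual': "\<phi>' \<in> dual" "\<psi>' \<in> dual" "bracket \<phi>' \<psi>' = bracket \<phi> \<psi>"
    by (auto simp: cubes_with_def)
  obtain g where "g \<in> carrier SL2" "dual_act g \<phi> = \<phi>'" "dual_act g \<psi> = \<psi>'"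
    using SL2_transitive[OF dual dual'(1,2) D dual'(3)] .
  then show "P \<in> orbit SL2 cubic_act (two_cubes c d \<phi> \<psi>)"
    unfolding orbit_def P using cubic_act_two_cubes[OF three dual] by fastforce
qed

lemma cubes_with_commute: "cubes_with d c (- D) = cubes_with c d D"
proof -
  have "cubes_with c d D \<subseteq> cubes_with d c (- D)" for c d D :: 'a
    unfolding cubes_with_def using bracket_commute two_cubes_commute by fastforce
  from this[of c d D] this[of d c "- D"] show ?thesis
    by auto
qed

lemma cubes_with_scale:
  fixes s t :: "'k::field"
  assumes "s \<noteq> 0" "t \<noteq> 0"
  shows "cubes_with (c * s ^ 3) (d * t ^ 3) D = cubes_with c d (s * t * D)"
proof -
  have sub: "cubes_with (c * s ^ 3) (d * t ^ 3) D \<subseteq> cubes_with c d (s * t * D)" for c d s t D :: 'k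
    unfolding cubes_with_def
    by clarify (metis two_cubes_scale dual_scale_in_dual bracket_scale mult.assoc)
  have cancel: "c * s ^ 3 * (1 / s) ^ 3 = c" "d * t ^ 3 * (1 / t) ^ 3 = d"
    "1 / s * (1 / t) * (s * t * D) = D"
    using assms by (simp_all add: power_divide)
  show ?thesis
    using sub[of c s d t D] sub[of "c * s ^ 3" "1 / s" "d * t ^ 3" "1 / t" "s * t * D"]
    unfolding cancel by (rule equalityI)
qed

text \<open>
  Rescale both forms by \<open>d D\<close>.
\<close>

lemma cubes_with_normal_form:
  fixes c d D :: "'k::field"
  assumes "c \<noteq> 0" "d \<noteq> 0" "D \<noteq> 0"
  defines "w \<equiv> c * d * D ^ 3" and "\<alpha> \<equiv> c / d"
  shows "cubes_with c d D = cubes_with (\<alpha> ^ 2 / w) (\<alpha> / w) (w / \<alpha>)"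
proof -
  have "c = \<alpha> ^ 2 / w * (d * D) ^ 3" "d = \<alpha> / w * (d * D) ^ 3" "w / \<alpha> = d * D * (d * D) * D"
    using assms(1-3) by (auto simp: w_def \<alpha>_def field_simps power2_eq_square power3_eq_cube)
  then show ?thesis
    using cubes_with_scale[of "d * D" "d * D" "\<alpha> ^ 2 / w" "\<alpha> / w" D] assms(1-3) by simp
qed

text \<open>
  If the classes agree, then up to exchanging the two cubes \<open>w\<close> is the same and \<open>\<alpha>\<close> changes by a
  cube \<open>t\<^sup>3\<close>.  In the normal form this multiplies the coefficients by \<open>t\<^sup>6\<close> and \<open>t\<^sup>3\<close> and the
  bracket by \<open>1 / t\<^sup>3\<close>, which rescaling the forms by \<open>t\<^sup>2\<close> and \<open>t\<close> undoes.
\<close>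

lemma cubes_with_cong:
  fixes c d D :: "'k::field"
  assumes nz: "c \<noteq> 0" "d \<noteq> 0" "D \<noteq> 0" "c' \<noteq> 0" "d' \<noteq> 0" "D' \<noteq> 0"
    and eq: "cubes_class c d D = cubes_class c' d' D'"
  shows "cubes_with c d D = cubes_with c' d' D'"
proof -
  have main: "cubes_with c d D = cubes_with c' d' D'"
    if nz: "c \<noteq> 0" "d \<noteq> 0" "D \<noteq> 0" "c' \<noteq> 0" "d' \<noteq> 0" "D' \<noteq> 0"
      and w: "c * d * D ^ 3 = c' * d' * D' ^ 3" and \<alpha>: "cube_class (c / d) = cube_class (c' / d')"
    for c d D c' d' D' :: 'k
  proof -
    define w where "w = c' * d' * D' ^ 3"
    define \<alpha> where "\<alpha> = c' / d'"
    obtain t where t: "t \<noteq> 0" "c / d = \<alpha> * t ^ 3"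
      using \<alpha> cube_class_eq_iff[of "c / d" "c' / d'"] nz by (auto simp: \<alpha>_def)
    have "w \<noteq> 0" "\<alpha> \<noteq> 0"
      using nz by (simp_all add: w_def \<alpha>_def)
    have "cubes_with c d D =
        cubes_with ((\<alpha> * t ^ 3) ^ 2 / w) (\<alpha> * t ^ 3 / w) (w / (\<alpha> * t ^ 3))"
      using cubes_with_normal_form[of c d D] nz t w by (simp add: w_def)
    also have "\<dots> = cubes_with (\<alpha> ^ 2 / w * (t ^ 2) ^ 3) (\<alpha> / w * t ^ 3) (w / (\<alpha> * t ^ 3))"
      by (simp add: power_mult_distrib flip: power_mult)
    also have "\<dots> = cubes_with (\<alpha> ^ 2 / w) (\<alpha> / w) (t ^ 2 * t * (w / (\<alpha> * t ^ 3)))"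
      using t by (intro cubes_with_scale) auto
    also have "t ^ 2 * t * (w / (\<alpha> * t ^ 3)) = w / \<alpha>"
      using t by (simp add: field_simps power2_eq_square power3_eq_cube)
    also have "cubes_with (\<alpha> ^ 2 / w) (\<alpha> / w) (w / \<alpha>) = cubes_with c' d' D'"
      using cubes_with_normal_form[of c' d' D'] nz by (simp add: w_def \<alpha>_def)
    finally show ?thesis .
  qed
  have "(c * d * D ^ 3, cube_class (c / d)) \<in> cubes_class c' d' D'"
    unfolding eq[symmetric] using nz by (simp add: cubes_class_def twisted_class_cube_class)
  then have "c * d * D ^ 3 = c' * d' * D' ^ 3 \<and> cube_class (c / d) = cube_class (c' / d') \<or>
      c * d * D ^ 3 = - (c' * d' * D' ^ 3) \<and> cube_class (c / d) = cube_class (d' / c')"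
    using nz twisted_class_cube_class[of "c' / d'"] by (simp add: cubes_class_def)
  then consider "c * d * D ^ 3 = c' * d' * D' ^ 3" "cube_class (c / d) = cube_class (c' / d')"
    | "c * d * D ^ 3 = - (c' * d' * D' ^ 3)" "cube_class (c / d) = cube_class (d' / c')"
    by blast
  then show ?thesis
  proof cases
    case 1
    then show ?thesis
      by (rule main[OF nz])
  next
    case 2
    then have "c * d * D ^ 3 = d' * c' * (- D') ^ 3"
      by (simp add: mult.commute)
    then have "cubes_with c d D = cubes_with d' c' (- D')"
      by (intro main nz 2(2)) (simp add: nz)
    then show ?thesis
      by (simp add: cubes_with_commute)
  qed
qed

lemma cubes_class_surj:
  fixes w \<alpha> :: "'k::field"
  assumes "w \<noteq> 0" "\<alpha> \<noteq> 0"
  shows "cubes_class (\<alpha> ^ 2 / w) (\<alpha> / w) (w / \<alpha>) = twisted_class w (cube_class \<alpha>)"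
proof -
  have "\<alpha> ^ 2 / w * (\<alpha> / w) * (w / \<alpha>) ^ 3 = w" "\<alpha> ^ 2 / w / (\<alpha> / w) = \<alpha>"
    using assms by (simp_all add: field_simps power2_eq_square power3_eq_cube)
  then show ?thesis
    by (simp only: cubes_class_def)
qed

lemma orbit_eq_iff_I_O1_eq:
  fixes P P' :: "'k::field poly poly"
  assumes two: "(2::'k) \<noteq> 0" and three: "(3::'k) \<noteq> 0" and "P \<in> O1" "P' \<in> O1"
  shows "orbit SL2 cubic_act P' = orbit SL2 cubic_act P \<longleftrightarrow> I_O1 P' = I_O1 P"
proof -
  obtain c d \<phi> \<psi> where P: "\<phi> \<in> dual" "\<psi> \<in> dual" "c \<noteq> 0" "d \<noteq> 0" "bracket \<phi> \<psi> \<noteq> 0"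
    "P = two_cubes c d \<phi> \<psi>"
    using O1_two_cubes[OF two three assms(3)] .
  obtain c' d' \<phi>' \<psi>' where P': "\<phi>' \<in> dual" "\<psi>' \<in> dual" "c' \<noteq> 0" "d' \<noteq> 0"
    "bracket \<phi>' \<psi>' \<noteq> 0" "P' = two_cubes c' d' \<phi>' \<psi>'"
    using O1_two_cubes[OF two three assms(4)] .
  have I: "I_O1 P = cubes_class c d (bracket \<phi> \<psi>)"
    unfolding P(6) by (rule I_O1_two_cubes) (fact three P)+
  have I': "I_O1 P' = cubes_class c' d' (bracket \<phi>' \<psi>')"
    unfolding P'(6) by (rule I_O1_two_cubes) (fact three P')+
  have orb: "orbit SL2 cubic_act P = cubes_with c d (bracket \<phi> \<psi>)"
    unfolding P(6) by (rule orbit_two_cubes) (fact three P)+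
  have orb': "orbit SL2 cubic_act P' = cubes_with c' d' (bracket \<phi>' \<psi>')"
    unfolding P'(6) by (rule orbit_two_cubes) (fact three P')+
  show ?thesis
  proof
    assume "orbit SL2 cubic_act P' = orbit SL2 cubic_act P"
    moreover have "P' \<in> cubes_with c' d' (bracket \<phi>' \<psi>')"
      using P' unfolding cubes_with_def by blast
    ultimately have "P' \<in> cubes_with c d (bracket \<phi> \<psi>)"
      by (simp add: orb orb')
    then obtain \<phi>'' \<psi>'' where P'': "\<phi>'' \<in> dual" "\<psi>'' \<in> dual" "bracket \<phi>'' \<psi>'' = bracket \<phi> \<psi>"
      "P' = two_cubes c d \<phi>'' \<psi>''"
      by (auto simp: cubes_with_def)
    then have "I_O1 P' = cubes_class c d (bracket \<phi>'' \<psi>'')"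
      using I_O1_two_cubes[OF three P''(1,2) P(3,4)] P(5) by simp
    then show "I_O1 P' = I_O1 P"
      by (simp add: I P'')
  next
    assume "I_O1 P' = I_O1 P"
    then show "orbit SL2 cubic_act P' = orbit SL2 cubic_act P"
      unfolding I I' orb orb' by (intro cubes_with_cong P P')
  qed
qed

lemma I_O1_image:
  assumes two: "(2::'k::field) \<noteq> 0" and three: "(3::'k) \<noteq> 0"
  shows "I_O1 ` (O1 :: 'k poly poly set) = twisted_product"
proof (intro equalityI subsetI)
  fix \<beta> assume "\<beta> \<in> I_O1 ` (O1 :: 'k poly poly set)"
  then obtain P :: "'k poly poly" where \<beta>: "\<beta> = I_O1 P" and "P \<in> O1"
    by blast
  then obtain c d \<phi> \<psi> where P: "\<phi> \<in> dual" "\<psi> \<in> dual" "c \<noteq> 0" "d \<noteq> 0" "bracket \<phi> \<psi> \<noteq> 0"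
    "P = two_cubes c d \<phi> \<psi>"
    using O1_two_cubes[OF two three] by metis
  have "\<beta> = twisted_class (c * d * bracket \<phi> \<psi> ^ 3) (cube_class (c / d))"
    unfolding \<beta> P(6) using I_O1_two_cubes[OF three P(1-5)] by (simp add: cubes_class_def)
  moreover have "c * d * bracket \<phi> \<psi> ^ 3 \<noteq> 0" "c / d \<noteq> 0"
    using P by simp_all
  ultimately show "\<beta> \<in> twisted_product"
    unfolding twisted_product_eq by blast
next
  fix \<beta> :: "('k \<times> 'k set) set" assume "\<beta> \<in> twisted_product"
  then obtain w \<alpha> where \<beta>: "\<beta> = twisted_class w (cube_class \<alpha>)" and nz: "w \<noteq> 0" "\<alpha> \<noteq> 0"
    by (auto simp: twisted_product_eq)
  let ?\<psi> = "lin 0 (w / \<alpha>)"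
  have br: "bracket (lin 1 0) ?\<psi> = w / \<alpha>"
    by (simp add: bracket_def)
  let ?P = "two_cubes (\<alpha> ^ 2 / w) (\<alpha> / w) (lin 1 0) ?\<psi>"
  have "I_O1 ?P = \<beta>"
    using I_O1_two_cubes[OF three lin_in_dual lin_in_dual, of "\<alpha> ^ 2 / w" "\<alpha> / w" 1 0 0 "w / \<alpha>"] nz
    by (simp add: br cubes_class_surj \<beta>)
  moreover have "?P \<in> O1"
    using nz by (intro two_cubes_in_O1 three) (simp_all add: br)
  ultimately show "\<beta> \<in> I_O1 ` O1"
    by blast
qed

section \<open>Stabilizers\<close>

text \<open>
  By uniqueness a stabilising element either scales each form, by \<open>s\<close> and \<open>t\<close>, or exchanges their
  lines.  Since brackets are preserved, \<open>s t = 1\<close> in the first case and \<open>s t = - 1\<close> in the second.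
  Comparing coefficients in the second case gives \<open>d = c s\<^sup>3\<close> and \<open>c = d t\<^sup>3\<close>, so
  \<open>(s t)\<^sup>3 = 1\<close>, which contradicts \<open>2 \<noteq> 0\<close>.
\<close>

lemma stabilizer_two_cubes:
  fixes \<phi> :: "'k::field ^ 2 \<Rightarrow> 'k"
  assumes two: "(2::'k) \<noteq> 0" and three: "(3::'k) \<noteq> 0" and dual: "\<phi> \<in> dual" "\<psi> \<in> dual"
    and c: "c \<noteq> 0" "d \<noteq> 0" and D: "bracket \<phi> \<psi> \<noteq> 0"
  shows "stabilizer SL2 cubic_act (two_cubes c d \<phi> \<psi>) =
    {g \<in> carrier SL2. \<exists>\<mu>. \<mu> \<noteq> 0 \<and> dual_act g \<phi> = dual_scale \<mu> \<phi> \<and>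
      dual_act g \<psi> = dual_scale (1 / \<mu>) \<psi> \<and> \<mu> ^ 3 = 1}"
proof -
  have "cubic_act g (two_cubes c d \<phi> \<psi>) = two_cubes c d \<phi> \<psi> \<longleftrightarrow>
    (\<exists>\<mu>. \<mu> \<noteq> 0 \<and> dual_act g \<phi> = dual_scale \<mu> \<phi> \<and>
      dual_act g \<psi> = dual_scale (1 / \<mu>) \<psi> \<and> \<mu> ^ 3 = 1)" (is "?fix \<longleftrightarrow> ?diag")
    if g: "g \<in> carrier SL2" for g
  proof
    assume ?fix
    then have eq: "two_cubes c d \<phi> \<psi> = two_cubes c d (dual_act g \<phi>) (dual_act g \<psi>)"
      by (simp add: cubic_act_two_cubes[OF three dual])
    have dual': "dual_act g \<phi> \<in> dual" "dual_act g \<psi> \<in> dual"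
      using dual by (simp_all add: dual_act_in_dual)
    have br: "bracket (dual_act g \<phi>) (dual_act g \<psi>) = bracket \<phi> \<psi>"
      using g dual by (rule bracket_dual_act)
    then have D': "bracket (dual_act g \<phi>) (dual_act g \<psi>) \<noteq> 0"
      using D by simp
    show ?diag
      using three dual dual' c D D' eq
    proof (cases rule: two_cubes_unique)
      case (aligned s t)
      have "s * t = 1"
        using br D by (simp add: aligned(3,4) mult.commute)
      then have "t = 1 / s"
        using aligned(1) by (simp add: field_simps)
      moreover have "s ^ 3 = 1"
        using aligned c by simp
      ultimately show ?diag
        using aligned by blast
    next
      case (swapped s t)
      have "(s * t + 1) * bracket \<phi> \<psi> = 0"
      proof -
        have "(s * t + 1) * bracket \<phi> \<psi> = bracket \<phi> \<psi> - bracket (dual_act g \<phi>) (dual_act g \<psi>)"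
          by (simp add: swapped(3,4) bracket_commute[of \<psi> \<phi>] algebra_simps)
        then show ?thesis
          by (simp add: br)
      qed
      then have "s * t = - 1"
        using D by (simp add: eq_neg_iff_add_eq_0)
      have "c * d = c * d * (s * t) ^ 3"
        using swapped(5,6) by algebra
      then have "(1::'k) = - 1"
        using c unfolding \<open>s * t = - 1\<close> by simp
      then have "(2::'k) = 0"
        by (metis add.right_inverse one_add_one)
      then show ?diag
        using two by simp
    qed
  next
    assume ?diag
    then obtain \<mu> where "\<mu> \<noteq> 0" "dual_act g \<phi> = dual_scale \<mu> \<phi>"
      "dual_act g \<psi> = dual_scale (1 / \<mu>) \<psi>" "\<mu> ^ 3 = 1"
      by blast
    then show ?fix
      by (simp add: cubic_act_two_cubes[OF three dual] two_cubes_scale power_divide)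
  qed
  then show ?thesis
    by (auto simp: stabilizer_def)
qed

section \<open>Classification\<close>

lemma numeral_nonzero:
  assumes "CHAR('k::field) \<noteq> 2" and "CHAR('k) \<noteq> 3"
  shows "(2::'k) \<noteq> 0" "(3::'k) \<noteq> 0"
proof -
  have "of_nat p \<noteq> (0::'k)" if "prime p" "CHAR('k) \<noteq> p" for p
    using that by (auto simp: of_nat_eq_0_iff_char_dvd prime_nat_iff)
  from this[of 2] this[of 3] assms show "(2::'k) \<noteq> 0" "(3::'k) \<noteq> 0"
    by auto
qed

theorem theorem3p33:
  assumes "CHAR('k::field) \<noteq> 2" and "CHAR('k) \<noteq> 3"
  shows
    "(\<forall>P \<in> (O1 :: 'k poly poly set). \<forall>P' \<in> O1.
        orbit SL2 cubic_act P' = orbit SL2 cubic_act P \<longleftrightarrow> I_O1 P' = I_O1 P)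
     \<and> (\<exists>F. (\<forall>P \<in> (O1 :: 'k poly poly set). F (orbit SL2 cubic_act P) = I_O1 P) \<and>
          bij_betw F (orbits SL2 (O1 :: 'k poly poly set) cubic_act) twisted_product)
     \<and> (\<forall>P \<in> (O1 :: 'k poly poly set). \<forall>c\<^sub>1 c\<^sub>2 \<phi>\<^sub>1 \<phi>\<^sub>2.
          c\<^sub>1 \<noteq> 0 \<and> c\<^sub>2 \<noteq> 0 \<and> dual_basis \<phi>\<^sub>1 \<phi>\<^sub>2 \<and>
          P = scal c\<^sub>1 (form \<phi>\<^sub>1 ^ 3) + scal c\<^sub>2 (form \<phi>\<^sub>2 ^ 3) \<longrightarrow>
          stabilizer SL2 cubic_act P =
            {g \<in> carrier SL2. \<exists>\<mu>. \<mu> \<noteq> 0 \<and> dual_act g \<phi>\<^sub>1 = dual_scale \<mu> \<phi>\<^sub>1 \<and>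
               dual_act g \<phi>\<^sub>2 = dual_scale (1 / \<mu>) \<phi>\<^sub>2 \<and> \<mu> ^ 3 = 1})"
proof (intro conjI)
  note two = numeral_nonzero(1)[OF assms] and three = numeral_nonzero(2)[OF assms]
  show i: "\<forall>P \<in> (O1 :: 'k poly poly set). \<forall>P' \<in> O1.
      orbit SL2 cubic_act P' = orbit SL2 cubic_act P \<longleftrightarrow> I_O1 P' = I_O1 P"
    using orbit_eq_iff_I_O1_eq[OF two three] by blast
  \<comment> \<open>The induced map: by the first part any representative of an orbit may be used.\<close>
  define F where "F B = I_O1 (SOME P :: 'k poly poly. P \<in> O1 \<and> orbit SL2 cubic_act P = B)" for B
  have F: "F (orbit SL2 cubic_act P) = I_O1 P" if "P \<in> O1" for P
  proof -
    have "\<exists>R. R \<in> O1 \<and> orbit SL2 cubic_act R = orbit SL2 cubic_act P"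
      using that by blast
    then have "(SOME R. R \<in> O1 \<and> orbit SL2 cubic_act R = orbit SL2 cubic_act P) \<in> O1 \<and>
        orbit SL2 cubic_act (SOME R. R \<in> O1 \<and> orbit SL2 cubic_act R = orbit SL2 cubic_act P)
          = orbit SL2 cubic_act P"
      by (rule someI_ex)
    then show ?thesis
      unfolding F_def using i that by blast
  qed
  have orbs: "orbits SL2 O1 cubic_act = orbit SL2 cubic_act ` (O1 :: 'k poly poly set)"
    by (auto simp: orbits_def)
  have "inj_on F (orbits SL2 O1 cubic_act)"
    unfolding orbs by (rule inj_onI) (use F i in force)
  moreover have "F ` orbits SL2 O1 cubic_act = twisted_product"
    unfolding orbs image_image I_O1_image[OF two three, symmetric] using F by simp
  ultimately show "\<exists>F. (\<forall>P \<in> (O1 :: 'k poly poly set). F (orbit SL2 cubic_act P) = I_O1 P) \<and>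
      bij_betw F (orbits SL2 (O1 :: 'k poly poly set) cubic_act) twisted_product"
    unfolding bij_betw_def using F by blast
  show "\<forall>P \<in> (O1 :: 'k poly poly set). \<forall>c\<^sub>1 c\<^sub>2 \<phi>\<^sub>1 \<phi>\<^sub>2.
      c\<^sub>1 \<noteq> 0 \<and> c\<^sub>2 \<noteq> 0 \<and> dual_basis \<phi>\<^sub>1 \<phi>\<^sub>2 \<and>
      P = scal c\<^sub>1 (form \<phi>\<^sub>1 ^ 3) + scal c\<^sub>2 (form \<phi>\<^sub>2 ^ 3) \<longrightarrow>
      stabilizer SL2 cubic_act P =
        {g \<in> carrier SL2. \<exists>\<mu>. \<mu> \<noteq> 0 \<and> dual_act g \<phi>\<^sub>1 = dual_scale \<mu> \<phi>\<^sub>1 \<and>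
           dual_act g \<phi>\<^sub>2 = dual_scale (1 / \<mu>) \<phi>\<^sub>2 \<and> \<mu> ^ 3 = 1}"
    using stabilizer_two_cubes[OF two three] dual_basis_bracket
    unfolding two_cubes_def by blast
qed

end
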